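(* Let $\{r_n\}_{n\ge 0}$ be a polynomial sequence, and $u$ be an integer polynomial that satisfies $\{r_n\}_{n\ge 0}$. Then the following are equivalent: (a) The sequence $\{r_n\}_{n\ge 0}$ is a recurringly nilpotent sequence, i.e., $r_0$ is a pre-periodic point of $u$ (or $0$ is a periodic point of $u$). (b) There exists a positive integer $m$ such that either $r_m=r_{m+1}=0$, or $r_m=r_{m+2}=0$.
   Context: An integer polynomial is an element of $\mathbb{Z}[x]$. For $u\in\mathbb{Z}[x]$ and a positive integer $n$, $u^{(n)}$ denotes the $n$-fold composition $u\circ\cdots\circ u$, and $u^{(0)}(x)=x$. An integer sequence $\{r_n\}_{n\ge 0}$ is a polynomial sequence if it has a generating integer polynomial, i.e., there is a polynomial $u\in\mathbb{Z}[x]$ such that $u^{(n)}(r_0)=r_n$ for each positive integer $n$; in this case one also says that $u$ satisfies $\{r_n\}_{n\ge 0}$. An integer sequence $\{r_n\}_{n\ge 0}$ is recurringly nilpotent if $r_n=0$ for infinitely many $n$. An integer $s$ is a periodic point of $u$ if $u^{(n)}(s)=s$ for some positive integer $n$, and a pre-periodic point of $u$ if $u^{(k)}(s)$ is a periodic point of $u$ for some $k\ge 0$ (equivalently, the orbit of $u$ at $s$ is finite).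
   Formalization: The "i.e." in (a) is false as an equivalence (u = 1, r_n = 1 for all n); instead it is proved that recurringly nilpotent implies r_0 is pre-periodic, and is equivalent to 0 being a term of the sequence and a periodic point of u. *)

theory Defs
  imports Complex_Main "HOL-Computational_Algebra.Polynomial"
begin

text \<open>\<open>u\<^sup>(\<^sup>n\<^sup>)\<close> as an element of \<open>\<int>[x]\<close>: \<open>[:0, 1:]\<close> is the polynomial \<open>x\<close>.\<close>

definition poly_iter :: "int poly \<Rightarrow> nat \<Rightarrow> int poly" where
  "poly_iter u n = (pcompose u ^^ n) [:0, 1:]"

definition satisfies_seq :: "int poly \<Rightarrow> (nat \<Rightarrow> int) \<Rightarrow> bool" where
  "satisfies_seq u r \<longleftrightarrow> (\<forall>n>0. poly (poly_iter u n) (r 0) = r n)"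

definition polynomial_seq :: "(nat \<Rightarrow> int) \<Rightarrow> bool" where
  "polynomial_seq r \<longleftrightarrow> (\<exists>u. satisfies_seq u r)"

definition recurringly_nilpotent :: "(nat \<Rightarrow> int) \<Rightarrow> bool" where
  "recurringly_nilpotent r \<longleftrightarrow> infinite {n. r n = 0}"

definition periodic_point :: "int poly \<Rightarrow> int \<Rightarrow> bool" where
  "periodic_point u s \<longleftrightarrow> (\<exists>n>0. poly (poly_iter u n) s = s)"

definition preperiodic_point :: "int poly \<Rightarrow> int \<Rightarrow> bool" where
  "preperiodic_point u s \<longleftrightarrow> (\<exists>k. periodic_point u (poly (poly_iter u k) s))"

end

theory Submission
  imports Defs
begin

text \<open>
  Since \<open>x - y\<close> divides \<open>u(x) - u(y)\<close>, each difference of consecutive points of an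
  orbit divides the next one. Along a cycle all these differences therefore have the same absolute value.
  They cannot all be equal and nonzero, because the orbit returns to its start; so either they
  vanish or two consecutive ones are opposite, and every integer cycle has length at most 2.
\<close>

lemma poly_diff_dvd:
  fixes p :: "'a::comm_ring_1 poly"
  shows "x - y dvd poly p x - poly p y"
proof (induction p)
  case 0
  show ?case by simp
next
  case (pCons a p)
  have "poly (pCons a p) x - poly (pCons a p) y = x * (poly p x - poly p y) + (x - y) * poly p y"
    by (simp add: algebra_simps)
  then show ?case
    using pCons.IH by (metis dvd_add dvd_mult dvd_triv_left)
qed

lemma funpow_periodic:
  assumes "(f ^^ n) s = s"
  shows "(f ^^ (j * n)) s = s"
  by (induction j) (simp_all add: assms funpow_add)

text \<open>Divisibility of differences is the only property of polynomials that enters, so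
  \<open>f\<close> is any integer function having it.\<close>

lemma int_cycle_length_le_2:
  fixes f :: "int \<Rightarrow> int"
  assumes dvd: "\<And>x y. x - y dvd f x - f y"
    and n: "n > 0" and per: "(f ^^ n) s = s"
  shows "f (f s) = s"
proof -
  define d where "d k = (f ^^ Suc k) s - (f ^^ k) s" for k
  have step: "d k dvd d (Suc k)" for k
    using dvd unfolding d_def by simp
  have mono: "d k dvd d (k + i)" for k i
    by (induction i) (auto intro: dvd_trans step)
  have return: "d (k * n) = d 0" for k
    unfolding d_def using funpow_periodic[OF per, of k] by simp
  \<comment> \<open>Since \<open>n > 0\<close>, the index \<open>k * n\<close> is at least
    \<open>k\<close>, so going forward from \<open>k\<close> reaches a multiple of the period, where
    the difference is \<open>d 0\<close> again.\<close>
  have dvd0: "d k dvd d 0" for k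
    using mono[of k "k * n - k"] return[of k] n by simp
  have abs_eq: "\<bar>d k\<bar> = \<bar>d 0\<bar>" for k
    using mono[of 0 k] dvd0[of k] by (intro zdvd_antisym_abs) simp_all
  have "\<exists>k. (f ^^ (k + 2)) s = (f ^^ k) s"
  proof (rule ccontr)
    assume no: "\<nexists>k. (f ^^ (k + 2)) s = (f ^^ k) s"
    have eq: "d (Suc k) = d k" for k
    proof -
      \<comment> \<open>The sum telescopes to the displacement over two steps; once it is nonzero,
        equal absolute values force equal signs.\<close>
      have "d k + d (Suc k) \<noteq> 0"
        using no unfolding d_def by simp
      with abs_eq[of k] abs_eq[of "Suc k"] show ?thesis by linarith
    qed
    have const: "d k = d 0" for k
      by (induction k) (simp_all add: eq)
    \<comment> \<open>With constant differences the orbit is an arithmetic progression, which can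
      return to \<open>s\<close> only if its step is 0.\<close>
    have "(f ^^ k) s = s + int k * d 0" for k
    proof (induction k)
      case (Suc k)
      have "(f ^^ Suc k) s = (f ^^ k) s + d 0"
        using const[of k] unfolding d_def by simp
      with Suc show ?case by (simp add: algebra_simps)
    qed simp
    from this[of n] per n have "d 0 = 0" by simp
    moreover have "d 0 + d 1 \<noteq> 0"
      using no[simplified, rule_format, of 0] unfolding d_def by simp
    ultimately show False using const[of 1] by simp
  qed
  then obtain k where k: "(f ^^ (2 + k)) s = (f ^^ k) s"
    by (auto simp: add.commute)
  \<comment> \<open>Another \<open>j\<close> steps carry the 2-periodicity from the
    \<open>k\<close>-th iterate to the iterate \<open>k * n\<close>, which is \<open>s\<close>
    itself.\<close>
  define j where "j = k * n - k"
  have j: "j + k = k * n" using n by (simp add: j_def)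
  have "(f ^^ (2 + k * n)) s = (f ^^ j) ((f ^^ (2 + k)) s)"
    by (metis add.left_commute comp_apply funpow_add j)
  also have "\<dots> = (f ^^ (k * n)) s"
    unfolding k using j by (metis comp_apply funpow_add)
  finally have "(f ^^ 2) s = s"
    unfolding funpow_add by (simp add: funpow_periodic[OF per])
  then show ?thesis by (simp add: numeral_2_eq_2)
qed

lemma poly_poly_iter: "poly (poly_iter u n) x = (poly u ^^ n) x"
  unfolding poly_iter_def by (induction n) (simp_all add: poly_pcompose)

theorem theorem4p7:
  fixes r :: "nat \<Rightarrow> int" and u :: "int poly"
  assumes "polynomial_seq r"
    and "satisfies_seq u r"
  shows "(recurringly_nilpotent r \<longleftrightarrow>
            (\<exists>m>0. (r m = 0 \<and> r (m + 1) = 0) \<or> (r m = 0 \<and> r (m + 2) = 0)))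
         \<and> (recurringly_nilpotent r \<longrightarrow> preperiodic_point u (r 0))
         \<and> (recurringly_nilpotent r \<longleftrightarrow> (\<exists>n. r n = 0) \<and> periodic_point u 0)"
proof -
  let ?f = "poly u"
  have r: "r n = (?f ^^ n) (r 0)" for n
    using assms(2) by (cases "n = 0") (simp_all add: satisfies_seq_def poly_poly_iter)
  have radd: "r (m + i) = (?f ^^ i) (r m)" for m i
    by (metis add.commute comp_apply funpow_add r)
  have periodic: "periodic_point u s \<longleftrightarrow> (\<exists>n>0. (?f ^^ n) s = s)" for s
    by (simp add: periodic_point_def poly_poly_iter)
  have rec_if: "recurringly_nilpotent r" if m: "r m = 0" and per: "periodic_point u 0" for m
  proof -
    from per obtain p where p: "p > 0" "(?f ^^ p) 0 = 0" by (auto simp: periodic)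
    have "range (\<lambda>j. m + j * p) \<subseteq> {n. r n = 0}"
      using radd m funpow_periodic[OF p(2)] by auto
    moreover have "infinite (range (\<lambda>j. m + j * p))"
      using p(1) by (intro range_inj_infinite injI) simp
    ultimately show ?thesis
      unfolding recurringly_nilpotent_def by (metis finite_subset)
  qed
  have rec_only: "\<exists>m>0. r m = 0 \<and> periodic_point u 0" if "recurringly_nilpotent r"
  proof -
    from that have inf: "\<exists>n>m. r n = 0" for m
      unfolding recurringly_nilpotent_def by (auto simp: infinite_nat_iff_unbounded)
    obtain m where m: "m > 0" "r m = 0" using inf by blast
    obtain n where n: "n > m" "r n = 0" using inf by blast
    \<comment> \<open>The gap between two zeros of the sequence is a period of 0.\<close>
    have "(?f ^^ (n - m)) 0 = 0"
      using radd[of m "n - m"] m n by simp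
    with n(1) m show ?thesis by (metis periodic zero_less_diff)
  qed
  have "recurringly_nilpotent r \<longleftrightarrow>
      (\<exists>m>0. (r m = 0 \<and> r (m + 1) = 0) \<or> (r m = 0 \<and> r (m + 2) = 0))"
  proof
    assume "recurringly_nilpotent r"
    then obtain m where m: "m > 0" "r m = 0" and "periodic_point u 0"
      using rec_only by blast
    \<comment> \<open>This also covers a fixed point 0, so the second disjunct can always be the one
      established.\<close>
    then have "?f (?f 0) = 0"
      by (auto simp: periodic intro: int_cycle_length_le_2 poly_diff_dvd)
    then have "r (m + 2) = 0"
      using m by (simp only: radd) (simp add: numeral_2_eq_2)
    with m show "\<exists>m>0. (r m = 0 \<and> r (m + 1) = 0) \<or> (r m = 0 \<and> r (m + 2) = 0)"
      by blast
  next
    assume "\<exists>m>0. (r m = 0 \<and> r (m + 1) = 0) \<or> (r m = 0 \<and> r (m + 2) = 0)"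
    \<comment> \<open>Both disjuncts are treated at once: \<open>i\<close> is 1 or 2 and serves as a
      period of 0.\<close>
    then obtain m i where "r m = 0" "r (m + i) = 0" "i > 0"
      by (metis zero_less_numeral zero_less_one)
    then show "recurringly_nilpotent r"
      using rec_if radd periodic by metis
  qed
  \<comment> \<open>The orbit of \<open>r 0\<close> enters the cycle of 0 at any index
    \<open>m\<close> with \<open>r m = 0\<close>.\<close>
  moreover have "preperiodic_point u (r 0)" if "recurringly_nilpotent r"
    using rec_only[OF that] unfolding preperiodic_point_def poly_poly_iter r[symmetric] by metis
  ultimately show ?thesis
    using rec_if rec_only by blast
qed

end
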